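(* Let $d \ge 1$, let $r>0$, let $A \subset \mathbb{R}^d$ be a Borel set and let $K \subset \mathbb{R}^d$ be compact and convex. Put $A_{r,K} = A + rK$. Then $$|\partial_K A_{r,K}|_+ \;\leq\; \frac{d}{r}\,|A_{r,K}|,$$ and this is tight: equality holds for $A=\{0\}$. In particular, with $A_r = A + rB_2^d$, $$|\partial A_r|_+ \;\leq\; \frac{d}{r}\,|A_r|.$$
   Context: For sets $A,B\subset\mathbb{R}^d$, the Minkowski sum is $A+B=\{a+b:\ a\in A,\ b\in B\}$, and $rK=\{rx: x\in K\}$. $B_2^d$ denotes the closed unit Euclidean ball in $\mathbb{R}^d$, and $|\cdot|$ denotes Lebesgue measure on $\mathbb{R}^d$. For a compact convex set $K$ and $r>0$ write $A_{r,K}=A+rK$; for $K=B_2^d$ write $A_r=A+rB_2^d$. For a measurable set $E\subset\mathbb{R}^d$ define $$|\partial E|_+=\limsup_{\varepsilon\to0^+}\frac{|E+\varepsilon B_2^d|-|E|}{\varepsilon},\qquad |\partial_K E|_+=\limsup_{\varepsilon\to0^+}\frac{|E+\varepsilon K|-|E|}{\varepsilon}.$$ In the claim these are applied to $E=A_r$ and $E=A_{r,K}$ respectively, so that for instance $|\partial_K A_{r,K}|_+=\limsup_{\varepsilon\to0^+}\frac{|A_{r,K}+\varepsilon K|-|A_{r,K}|}{\varepsilon}$. *)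

theory Defs
  imports "HOL-Analysis.Analysis"
begin

text \<open>
  Minkowski sums are written with \<open>+\<close> on sets, from \<^theory>\<open>HOL-Library.Set_Algebras\<close>.
  The measure takes values in \<^typ>\<open>ereal\<close> so that differences of volumes are not truncated at 0.
\<close>

definition vol :: "'a::euclidean_space set \<Rightarrow> ereal" where
  "vol E = enn2ereal (emeasure lebesgue E)"

definition dilate :: "real \<Rightarrow> 'a::real_vector set \<Rightarrow> 'a set" where
  "dilate t K = (\<lambda>x. t *\<^sub>R x) ` K"

text \<open>
  If \<open>vol E = \<infinity>\<close> then \<open>E + \<epsilon>K\<close> may have infinite volume as well; \<^typ>\<open>ereal\<close> takes
  \<open>\<infinity> - \<infinity> = \<infinity>\<close>.
\<close>

definition upper_surface_wrt :: "'a::euclidean_space set \<Rightarrow> 'a set \<Rightarrow> ereal" where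
  "upper_surface_wrt K E =
     Limsup (at_right 0) (\<lambda>\<epsilon>. (vol (E + dilate \<epsilon> K) - vol E) / ereal \<epsilon>)"

definition upper_surface :: "'a::euclidean_space set \<Rightarrow> ereal" where
  "upper_surface E =
     Limsup (at_right 0) (\<lambda>\<epsilon>. (vol (E + dilate \<epsilon> (cball 0 1)) - vol E) / ereal \<epsilon>)"

end

theory Submission imports Defs begin

text \<open>
  Convexity of \<open>K\<close> gives \<open>(A + r K) + \<epsilon> K = A + (r + \<epsilon>) K\<close>, so the surface bound is the derivative at
  \<open>\<epsilon> = 0\<close> of the growth estimate
    \<open>|A + s K| \<le> (s / r)\<^sup>d |A + r K|\<close> for \<open>0 < r \<le> s\<close>
  (lemma \<open>borel_plus_dilate_measure_le\<close>). For a one-point set \<open>A\<close> this is an equality, which gives tightness.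

  For finite \<open>A\<close> and \<open>K\<close> with the origin in its interior, divide space into Voronoi cells of the points of
  \<open>A\<close> with respect to the Minkowski functional of \<open>K\<close>. Each cell is star-shaped about its centre, so
  contraction by the factor \<open>r / s\<close> towards the centres maps the parts of \<open>A + s K\<close> in the cells into
  disjoint parts of \<open>A + r K\<close> and scales volume by \<open>(r / s)\<^sup>d\<close> (lemma \<open>finite_plus_dilate_measure_le\<close>). For
  compact \<open>A\<close> and arbitrary \<open>K\<close>, one passes to a finite net of \<open>A\<close> and thickens \<open>K\<close> by a small ball.

  The passage to Borel sets \<open>A\<close> needs descriptive set theory. When \<open>K\<close> has empty interior, \<open>A + r K\<close>
  need not be Borel: sums with a segment encode projections of Borel sets. It is Lebesgue measurable, and its
  measure is the supremum of \<open>|L + r K|\<close> over compact \<open>L \<subseteq> A\<close>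
  (lemmas \<open>borel_plus_compact_lebesgue\<close> and \<open>borel_plus_compact_inner_regular\<close>). Both follow from
  Choquet's capacity argument, applied to a representation of \<open>A\<close> as the projection of a closed subset
  of the product with the Baire space. The growth estimate then passes from \<open>L\<close> to \<open>A\<close>.
\<close>

section \<open>Minkowski sums and dilations\<close>

lemma compact_set_plus:
  fixes A B :: "'a::real_normed_vector set"
  assumes "compact A" "compact B" shows "compact (A + B)"
proof -
  have "A + B = {x + y | x y. x \<in> A \<and> y \<in> B}" by (auto simp: set_plus_def)
  then show ?thesis using compact_sums[OF assms] by simp
qed

lemma bounded_set_plus:
  fixes A B :: "'a::real_normed_vector set"
  assumes "bounded A" "bounded B" shows "bounded (A + B)"
proof -
  have "A + B = (\<Union>x\<in>A. \<Union>y\<in>B. {x + y})" by (auto simp: set_plus_def)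
  then show ?thesis using bounded_sums[OF assms] by simp
qed

lemma mem_dilate_iff: "t \<noteq> 0 \<Longrightarrow> x \<in> dilate t K \<longleftrightarrow> (1 / t) *\<^sub>R x \<in> K"
  unfolding dilate_def image_iff by (auto simp: divide_inverse intro!: bexI[of _ "(1 / t) *\<^sub>R x"])

lemma dilate_plus_dilate:
  assumes "convex K" "0 \<le> s" "0 \<le> t"
  shows "dilate s K + dilate t K = dilate (s + t) K"
proof (cases "s + t = 0")
  case True
  then have "s = 0" "t = 0" using assms by auto
  then show ?thesis by (auto simp: dilate_def set_plus_def image_def)
next
  case False
  then have st: "s + t > 0" using assms by auto
  show ?thesis
  proof (intro equalityI subsetI)
    fix z assume "z \<in> dilate s K + dilate t K"
    then obtain x y where xy: "x \<in> K" "y \<in> K" "z = s *\<^sub>R x + t *\<^sub>R y"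
      by (auto simp: dilate_def set_plus_def)
    have "(s / (s + t)) *\<^sub>R x + (t / (s + t)) *\<^sub>R y \<in> K"
      using xy st assms by (intro convexD) (auto simp: add_divide_distrib[symmetric])
    moreover have "z = (s + t) *\<^sub>R ((s / (s + t)) *\<^sub>R x + (t / (s + t)) *\<^sub>R y)"
      using st xy by (simp add: scaleR_add_right)
    ultimately show "z \<in> dilate (s + t) K" unfolding dilate_def by blast
  next
    fix z assume "z \<in> dilate (s + t) K"
    then show "z \<in> dilate s K + dilate t K"
      by (auto simp: dilate_def set_plus_def scaleR_add_left)
  qed
qed

lemma dilate_set_plus: "dilate t (A + B) = dilate t A + dilate t B"
  by (force simp: dilate_def set_plus_def scaleR_add_right)

lemma dilate_cball:
  fixes t :: real
  assumes "t > 0"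
  shows "dilate t (cball (0::'a::real_normed_vector) e) = cball 0 (t * e)"
proof (intro set_eqI)
  fix x :: 'a
  show "x \<in> dilate t (cball 0 e) \<longleftrightarrow> x \<in> cball 0 (t * e)"
    using assms mem_dilate_iff[of t x "cball 0 e"] by (simp add: field_simps)
qed

lemma compact_dilate:
  fixes K :: "'a::real_normed_vector set"
  shows "compact K \<Longrightarrow> compact (dilate t K)"
  unfolding dilate_def by (intro compact_continuous_image continuous_intros)

lemma dilated_sum:
  assumes "convex K" "0 \<le> r" "0 \<le> \<epsilon>"
  shows "(A + dilate r K) + dilate \<epsilon> K = A + dilate (r + \<epsilon>) K"
  using dilate_plus_dilate[OF assms] by (simp add: add.assoc)

section \<open>Analytic sets\<close>

text \<open>
  In a Euclidean space these are the analytic (Suslin) sets. A closed subset of the product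
  with the Baire space \<^typ>\<open>nat \<Rightarrow> nat\<close> is a convenient normal form, because countably many
  sequences can be coded in one: this gives closure under countable unions and intersections.
\<close>
definition analytic :: "'a::topological_space set \<Rightarrow> bool" where
  "analytic A \<longleftrightarrow> (\<exists>C :: ('a \<times> (nat \<Rightarrow> nat)) set. closed C \<and> A = fst ` C)"

lemma closed_imp_analytic: "closed A \<Longrightarrow> analytic A"
  unfolding analytic_def by (rule exI[of _ "A \<times> UNIV"]) (auto intro: closed_Times)

lemma continuous_on_snd_coordinate:
  "continuous_on UNIV (\<lambda>p :: 'a::topological_space \<times> ('i \<Rightarrow> 'b::topological_space). snd p i)"
  by (rule continuous_on_compose2[of UNIV "\<lambda>s. s i" UNIV snd])
    (auto intro: continuous_on_snd continuous_on_id)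

lemma continuous_on_Pair_reindex:
  "continuous_on UNIV (\<lambda>p :: 'a::topological_space \<times> ('i \<Rightarrow> 'b::topological_space). (fst p, \<lambda>k. snd p (g k)))"
  by (rule continuous_on_Pair[OF continuous_on_fst[OF continuous_on_id]
        continuous_on_coordinatewise_then_product[OF continuous_on_snd_coordinate]])

text \<open>
  A point of the union carries an index and a witness for that index; the pair is coded as a
  single sequence, whose head is the index. The coded set is closed because the head ranges over
  a discrete space.
\<close>
lemma analytic_UN:
  fixes A :: "nat \<Rightarrow> 'a::topological_space set"
  assumes "\<And>i. analytic (A i)"
  shows "analytic (\<Union>i. A i)"
proof -
  obtain D :: "nat \<Rightarrow> ('a \<times> (nat \<Rightarrow> nat)) set"
    where D: "\<And>i. closed (D i)" "\<And>i. A i = fst ` D i"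
    using assms unfolding analytic_def by metis
  let ?f = "\<lambda>p :: 'a \<times> (nat \<Rightarrow> nat). (fst p, \<lambda>k. snd p (Suc k))"
  let ?C = "{p. ?f p \<in> D (snd p 0)}"
  have f: "continuous_on UNIV ?f"
    by (rule continuous_on_Pair_reindex)
  have g: "continuous_on UNIV (\<lambda>p :: 'a \<times> (nat \<Rightarrow> nat). snd p 0)"
    by (rule continuous_on_snd_coordinate)
  have "- ?C = (\<Union>i. (\<lambda>p. snd p 0) -` {i} \<inter> ?f -` (- D i))"
    by auto
  moreover have "open ((\<lambda>p :: 'a \<times> (nat \<Rightarrow> nat). snd p 0) -` {i} \<inter> ?f -` (- D i))" for i
    using f g D(1) by (intro open_Int) (auto intro!: open_vimage open_discrete)
  ultimately have "closed ?C"
    unfolding closed_def by auto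
  moreover have "(\<Union>i. A i) = fst ` ?C"
  proof (intro equalityI subsetI)
    fix x assume "x \<in> (\<Union>i. A i)"
    then obtain i s where "(x, s) \<in> D i" using D(2) by force
    then have "(x, case_nat i s) \<in> ?C" by simp
    then show "x \<in> fst ` ?C" by (rule image_eqI[rotated]) simp
  next
    fix x assume "x \<in> fst ` ?C"
    then show "x \<in> (\<Union>i. A i)" using D(2) by force
  qed
  ultimately show ?thesis unfolding analytic_def by blast
qed

text \<open>
  A point of the intersection carries one witness for each index; the pairing function on the
  natural numbers interleaves them in a single sequence.
\<close>
lemma analytic_INT:
  fixes A :: "nat \<Rightarrow> 'a::topological_space set"
  assumes "\<And>i. analytic (A i)"
  shows "analytic (\<Inter>i. A i)"
proof -
  obtain D :: "nat \<Rightarrow> ('a \<times> (nat \<Rightarrow> nat)) set"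
    where D: "\<And>i. closed (D i)" "\<And>i. A i = fst ` D i"
    using assms unfolding analytic_def by metis
  let ?f = "\<lambda>i (p :: 'a \<times> (nat \<Rightarrow> nat)). (fst p, \<lambda>k. snd p (prod_encode (i, k)))"
  let ?C = "\<Inter>i. ?f i -` D i"
  have f: "continuous_on UNIV (?f i)" for i
    by (rule continuous_on_Pair_reindex)
  have "closed ?C"
    using f D(1) by (auto intro!: closed_INT closed_vimage)
  moreover have "(\<Inter>i. A i) = fst ` ?C"
  proof (intro equalityI subsetI)
    fix x assume "x \<in> (\<Inter>i. A i)"
    then have "\<forall>i. \<exists>s. (x, s) \<in> D i" using D(2) by force
    then obtain s where s: "\<And>i. (x, s i) \<in> D i" by metis
    have "(x, \<lambda>k. case prod_decode k of (i, j) \<Rightarrow> s i j) \<in> ?C" using s by simp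
    then show "x \<in> fst ` ?C" by (rule image_eqI[rotated]) simp
  next
    fix x assume "x \<in> fst ` ?C"
    then show "x \<in> (\<Inter>i. A i)" using D(2) by force
  qed
  ultimately show ?thesis unfolding analytic_def by blast
qed

text \<open>
  Complements of analytic sets need not be analytic, so the induction over the Borel
  \<open>\<sigma>\<close>-algebra carries the property for a set together with its complement.
\<close>
lemma borel_imp_analytic:
  fixes A :: "'a::euclidean_space set"
  assumes "A \<in> sets borel"
  shows "analytic A"
proof -
  have "A \<in> sigma_sets UNIV (Collect closed)"
    using assms by (simp add: borel_eq_closed)
  then have "analytic A \<and> analytic (- A)"
  proof induction
    case (Basic a)
    then have "open (- a)" by auto
    then obtain C :: "nat \<Rightarrow> 'a set" where "\<And>n. compact (C n)" "\<Union>(range C) = - a"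
      by (metis open_Union_compact_subsets)
    then have "analytic (- a)"
      using analytic_UN[of C] by (auto intro: closed_imp_analytic compact_imp_closed)
    with Basic show ?case by (auto intro: closed_imp_analytic)
  next
    case Empty
    show ?case by (auto intro: closed_imp_analytic)
  next
    case (Compl a)
    then show ?case by (simp add: Compl_eq_Diff_UNIV[symmetric])
  next
    case (Union a)
    then show ?case using analytic_UN[of a] analytic_INT[of "\<lambda>i. - a i"] by auto
  qed
  then show ?thesis ..
qed

section \<open>Sums of Borel and compact sets\<close>

lemma tendsto_fun_iff:
  fixes f :: "'c \<Rightarrow> 'i \<Rightarrow> 'b::topological_space"
  shows "(f \<longlongrightarrow> l) F \<longleftrightarrow> (\<forall>i. ((\<lambda>c. f c i) \<longlongrightarrow> l i) F)"
  using limitin_componentwise[of "\<lambda>_::'i. euclidean::'b topology" UNIV f l F]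
  by (simp add: euclidean_product_topology)

lemma compact_bounded_sequences: "compact {s :: nat \<Rightarrow> nat. \<forall>i. s i \<le> m i}"
proof -
  have "compact (PiE UNIV (\<lambda>i. {..m i}))"
    using compactin_PiE[of "\<lambda>_::nat. euclidean::nat topology" UNIV "\<lambda>i. {..m i}"]
    by (simp add: euclidean_product_topology finite_imp_compact)
  also have "PiE UNIV (\<lambda>i. {..m i}) = {s. \<forall>i. s i \<le> m i}"
    by (auto simp: PiE_def Pi_def)
  finally show ?thesis .
qed

text \<open>
  This replaces the continuity from above of the Minkowski sum in the capacity argument below: the sets
  in which only finitely many coordinates are bounded are not compact, but a sequence of
  points violating the conclusion for every \<open>n\<close> can be truncated to lie in the compact set of all
  sequences below \<open>m\<close>, and the truncation alters each coordinate only finitely often.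
\<close>
lemma bounded_coordinates_compactness:
  fixes C :: "('a::first_countable_topology \<times> (nat \<Rightarrow> nat)) set"
  assumes C: "closed C" and B: "compact B" "fst ` C \<subseteq> B"
    and U: "open U" "fst ` {p \<in> C. \<forall>i. snd p i \<le> m i} \<subseteq> U"
  obtains n where "fst ` {p \<in> C. \<forall>i<n. snd p i \<le> m i} \<subseteq> U"
proof (rule ccontr)
  assume "\<not> thesis"
  with that have "\<forall>n. \<exists>p. p \<in> C \<and> (\<forall>i<n. snd p i \<le> m i) \<and> fst p \<notin> U" by blast
  then obtain p where p: "\<And>n. p n \<in> C" "\<And>n i. i < n \<Longrightarrow> snd (p n) i \<le> m i" "\<And>n. fst (p n) \<notin> U"
    by metis
  \<comment> \<open>The truncated points need not lie in \<open>C\<close>, but their limit points do.\<close>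
  define q where "q n = (fst (p n), \<lambda>i. min (snd (p n) i) (m i))" for n
  let ?S = "B \<times> {s. \<forall>i. s i \<le> m i}"
  have "compact ?S" using B(1) compact_bounded_sequences by (rule compact_Times)
  then have "seq_compact ?S" by (rule compact_imp_seq_compact)
  moreover have "\<forall>n. q n \<in> ?S" using p(1) B(2) by (auto simp: q_def)
  ultimately obtain l r where l: "l \<in> ?S" and r: "strict_mono r" and lim: "(q \<circ> r) \<longlonglongrightarrow> l"
    by (rule seq_compactE)
  have lim1: "(\<lambda>n. fst (p (r n))) \<longlonglongrightarrow> fst l"
    using tendsto_fst[OF lim] by (simp add: q_def o_def)
  have "(\<lambda>n. snd (p (r n)) i) \<longlonglongrightarrow> snd l i" for i
  proof (rule Lim_transform_eventually)
    show "(\<lambda>n. snd (q (r n)) i) \<longlonglongrightarrow> snd l i"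
      using tendsto_snd[OF lim] by (simp add: tendsto_fun_iff o_def)
    show "\<forall>\<^sub>F n in sequentially. snd (q (r n)) i = snd (p (r n)) i"
    proof (rule eventually_sequentiallyI)
      fix n assume "Suc i \<le> n"
      then have "i < r n" using seq_suble[OF r, of n] by linarith
      then show "snd (q (r n)) i = snd (p (r n)) i" using p(2) by (simp add: q_def)
    qed
  qed
  then have "(\<lambda>n. snd (p (r n))) \<longlonglongrightarrow> snd l" by (simp add: tendsto_fun_iff)
  with lim1 have "(\<lambda>n. (fst (p (r n)), snd (p (r n)))) \<longlonglongrightarrow> (fst l, snd l)"
    by (rule tendsto_Pair)
  then have "l \<in> C"
    using closed_sequentially[OF C, of "\<lambda>n. p (r n)" l] p(1) by simp
  with l have "l \<in> {p \<in> C. \<forall>i. snd p i \<le> m i}" by auto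
  then have "fst l \<in> U" using U(2) by blast
  moreover have "fst l \<in> - U"
    using closed_sequentially[OF _ _ lim1, of "- U"] U(1) p(3) by auto
  ultimately show False by simp
qed

lemma open_translates_subset:
  fixes G K :: "'a::real_normed_vector set"
  assumes "open G" "compact K"
  shows "open {x. \<forall>k\<in>K. x + k \<in> G}"
proof -
  have "- {x. \<forall>k\<in>K. x + k \<in> G} = (\<Union>x\<in>- G. \<Union>y\<in>K. {x - y})"
    by (force simp: algebra_simps)
  then show ?thesis
    using closed_compact_differences[of "- G" K] assms by (simp add: open_closed)
qed

lemma compact_sets_lebesgue [simp]:
  fixes K :: "'a::euclidean_space set"
  shows "compact K \<Longrightarrow> K \<in> sets lebesgue"
  by (simp add: compact_imp_closed)

text \<open>
  Choquet's capacity argument. Bounds on the coordinates are imposed one after the other; continuity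
  from below of the outer measure allows each bound to be chosen so large that the sum with \<open>K\<close>
  keeps outer measure above \<open>a\<close>. With all coordinates bounded the projection is a compact set
  \<open>L\<close>, and every open set around \<open>L + K\<close> contains one of the earlier sums, so
  outer regularity gives the bound for \<open>L + K\<close> itself.
\<close>
lemma analytic_plus_compact_approx:
  fixes A K :: "'a::euclidean_space set"
  assumes A: "analytic A" "bounded A" and K: "compact K"
    and a: "a < outer_measure_of lebesgue (A + K)"
  obtains L where "compact L" "L \<subseteq> A" "a \<le> emeasure lebesgue (L + K)"
proof -
  let ?\<mu> = "outer_measure_of (lebesgue :: 'a measure)"
  obtain C :: "('a \<times> (nat \<Rightarrow> nat)) set" where C: "closed C" "A = fst ` C"
    using A(1) unfolding analytic_def by blast
  have "\<exists>D. \<forall>n. (a < ?\<mu> (fst ` D n + K) \<and> (n = 0 \<longrightarrow> D n = C)) \<and>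
                (\<exists>k. D (Suc n) = {p \<in> D n. snd p n \<le> k})"
  proof (rule dependent_nat_choice)
    show "\<exists>D. a < ?\<mu> (fst ` D + K) \<and> ((0::nat) = 0 \<longrightarrow> D = C)"
      using a C(2) by auto
  next
    fix D :: "('a \<times> (nat \<Rightarrow> nat)) set" and n :: nat
    assume D: "a < ?\<mu> (fst ` D + K) \<and> (n = 0 \<longrightarrow> D = C)"
    let ?E = "\<lambda>k. fst ` {p \<in> D. snd p n \<le> k} + K"
    have "incseq ?E" by (intro monoI set_plus_mono2 image_mono) auto
    moreover have "(\<Union>k. ?E k) = fst ` D + K" by (force simp: set_plus_def)
    ultimately have "(SUP k. ?\<mu> (?E k)) = ?\<mu> (fst ` D + K)"
      using SUP_outer_measure_of_incseq[of ?E lebesgue] by simp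
    then obtain k where "a < ?\<mu> (?E k)"
      using D less_SUP_iff[of a "\<lambda>k. ?\<mu> (?E k)" UNIV] by auto
    then show "\<exists>D'. (a < ?\<mu> (fst ` D' + K) \<and> (Suc n = 0 \<longrightarrow> D' = C)) \<and>
                    (\<exists>k. D' = {p \<in> D. snd p n \<le> k})"
      by auto
  qed
  then obtain D where D': "\<forall>n. (a < ?\<mu> (fst ` D n + K) \<and> (n = 0 \<longrightarrow> D n = C)) \<and>
      (\<exists>k. D (Suc n) = {p \<in> D n. snd p n \<le> k})" ..
  then have D: "\<And>n. a < ?\<mu> (fst ` D n + K)" "D 0 = C" by blast+
  have "\<forall>n. \<exists>k. D (Suc n) = {p \<in> D n. snd p n \<le> k}" using D' by blast
  then have "\<exists>m. \<forall>n. D (Suc n) = {p \<in> D n. snd p n \<le> m n}" by (rule choice)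
  then obtain m where m: "\<And>n. D (Suc n) = {p \<in> D n. snd p n \<le> m n}" by blast
  have D_eq: "D n = {p \<in> C. \<forall>i<n. snd p i \<le> m i}" for n
    by (induction n) (auto simp: D(2) m less_Suc_eq)
  define L where "L = fst ` {p \<in> C. \<forall>i. snd p i \<le> m i}"
  have B: "compact (closure A)" "fst ` C \<subseteq> closure A"
    using A(2) C(2) closure_subset[of A] by (simp_all only: compact_closure)
  have "compact (C \<inter> (closure A \<times> {s. \<forall>i. s i \<le> m i}))"
    using C(1) B(1) by (intro closed_Int_compact compact_Times compact_bounded_sequences)
  moreover have "C \<inter> (closure A \<times> {s. \<forall>i. s i \<le> m i}) = {p \<in> C. \<forall>i. snd p i \<le> m i}"
    using B(2) by auto
  ultimately have L: "compact L"
    unfolding L_def by (simp add: compact_continuous_image continuous_on_fst)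
  have "a \<le> emeasure lebesgue (L + K)"
  proof (rule ennreal_le_epsilon)
    fix e :: real assume e: "e > 0"
    have LK: "L + K \<in> sets lebesgue" using L K by (simp add: compact_set_plus)
    obtain G where G: "open G" "L + K \<subseteq> G" "emeasure lebesgue (G - (L + K)) < ennreal e"
      using sets_lebesgue_outer_open[OF LK e] by metis
    have "fst ` {p \<in> C. \<forall>i. snd p i \<le> m i} \<subseteq> {x. \<forall>k\<in>K. x + k \<in> G}"
      unfolding L_def[symmetric] using G(2) by blast
    from bounded_coordinates_compactness[OF C(1) B open_translates_subset[OF G(1) K] this]
    obtain n where "fst ` {p \<in> C. \<forall>i<n. snd p i \<le> m i} \<subseteq> {x. \<forall>k\<in>K. x + k \<in> G}" .
    then have "\<And>x k. x \<in> fst ` D n \<Longrightarrow> k \<in> K \<Longrightarrow> x + k \<in> G"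
      unfolding D_eq by blast
    then have "fst ` D n + K \<subseteq> G" by (auto simp only: set_plus_def)
    then have "?\<mu> (fst ` D n + K) \<le> ?\<mu> G" by (rule outer_measure_of_mono)
    also have "\<dots> = emeasure lebesgue G" using G(1) by simp
    also have "\<dots> = emeasure lebesgue ((L + K) \<union> (G - (L + K)))"
      using G(2) by (simp add: Un_absorb1)
    also have "\<dots> \<le> emeasure lebesgue (L + K) + emeasure lebesgue (G - (L + K))"
      using LK G(1) by (intro emeasure_subadditive) auto
    also have "\<dots> \<le> emeasure lebesgue (L + K) + ennreal e"
      using G(3) by (intro add_left_mono) auto
    finally show "a \<le> emeasure lebesgue (L + K) + ennreal e"
      using D(1)[of n] by (meson less_le_trans less_imp_le)
  qed
  moreover have "L \<subseteq> A" unfolding L_def C(2) by auto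
  ultimately show thesis using L that by blast
qed

lemma plus_eq_UN_truncations:
  fixes A K :: "'a::real_normed_vector set"
  shows "A + K = (\<Union>n. A \<inter> cball 0 (real n) + K)"
proof (intro equalityI subsetI)
  fix z assume "z \<in> A + K"
  then obtain x k where "x \<in> A" "k \<in> K" "z = x + k" by (auto simp: set_plus_def)
  moreover obtain n where "norm x \<le> real n" using real_arch_simple by blast
  ultimately show "z \<in> (\<Union>n. A \<inter> cball 0 (real n) + K)" by (auto intro!: set_plus_intro)
qed (auto simp: set_plus_def)

text \<open>
  The approximating compact sets have the form \<open>L + K\<close> with \<open>L \<subseteq> A\<close>. Ordinary inner regularity would give
  compact subsets of \<open>A + K\<close> without this structure, which could not be dilated.
\<close>
lemma borel_plus_compact_inner_regular:
  fixes A K :: "'a::euclidean_space set"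
  assumes A: "A \<in> sets borel" and K: "compact K"
  shows "outer_measure_of lebesgue (A + K)
           = (SUP L\<in>{L. compact L \<and> L \<subseteq> A}. emeasure lebesgue (L + K))"
proof (rule antisym)
  show "outer_measure_of lebesgue (A + K) \<le> (SUP L\<in>{L. compact L \<and> L \<subseteq> A}. emeasure lebesgue (L + K))"
  proof (rule dense_le)
    fix a assume a: "a < outer_measure_of lebesgue (A + K)"
    let ?A = "\<lambda>n. A \<inter> cball 0 (real n)"
    have "incseq (\<lambda>n. ?A n + K)" by (intro monoI set_plus_mono2) auto
    moreover have "(\<Union>n. ?A n + K) = A + K"
      by (rule plus_eq_UN_truncations[symmetric])
    ultimately have "(SUP n. outer_measure_of lebesgue (?A n + K)) = outer_measure_of lebesgue (A + K)"
      using SUP_outer_measure_of_incseq[of "\<lambda>n. ?A n + K" lebesgue] by simp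
    then obtain n where "a < outer_measure_of lebesgue (?A n + K)"
      using a less_SUP_iff[of a "\<lambda>n. outer_measure_of lebesgue (?A n + K)" UNIV] by auto
    moreover have "analytic (?A n)" using A by (intro borel_imp_analytic) auto
    moreover have "bounded (?A n)" by (rule bounded_Int) auto
    ultimately obtain L where "compact L" "L \<subseteq> ?A n" "a \<le> emeasure lebesgue (L + K)"
      using K analytic_plus_compact_approx by blast
    then show "a \<le> (SUP L\<in>{L. compact L \<and> L \<subseteq> A}. emeasure lebesgue (L + K))"
      by (intro SUP_upper2[of L]) auto
  qed
  show "(SUP L\<in>{L. compact L \<and> L \<subseteq> A}. emeasure lebesgue (L + K)) \<le> outer_measure_of lebesgue (A + K)"
  proof (rule SUP_least)
    fix L assume L: "L \<in> {L. compact L \<and> L \<subseteq> A}"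
    then have "emeasure lebesgue (L + K) = outer_measure_of lebesgue (L + K)"
      using K by (simp add: compact_set_plus)
    also have "\<dots> \<le> outer_measure_of lebesgue (A + K)"
      using L by (intro outer_measure_of_mono set_plus_mono2) auto
    finally show "emeasure lebesgue (L + K) \<le> outer_measure_of lebesgue (A + K)" .
  qed
qed

text \<open>
  Outer and inner approximation have the same finite measure, so their difference is a null set
  and completeness of Lebesgue measure applies. The sum is in general only analytic, not Borel.
\<close>
lemma borel_plus_compact_lebesgue_bounded:
  fixes A K :: "'a::euclidean_space set"
  assumes A: "A \<in> sets borel" "bounded A" and K: "compact K"
  shows "A + K \<in> sets lebesgue"
proof -
  let ?I = "{L. compact L \<and> L \<subseteq> A}"
  let ?V = "outer_measure_of lebesgue (A + K)"
  have "?I \<noteq> {}" using compact_empty by blast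
  then obtain f :: "nat \<Rightarrow> ennreal"
    where f: "range f \<subseteq> (\<lambda>L. emeasure lebesgue (L + K)) ` ?I"
      "(SUP L\<in>?I. emeasure lebesgue (L + K)) = (SUP n. f n)"
    using ennreal_SUP_countable_SUP[of ?I "\<lambda>L. emeasure lebesgue (L + K)"] by auto
  have "\<forall>n. \<exists>L. L \<in> ?I \<and> f n = emeasure lebesgue (L + K)" using f(1) by blast
  then obtain L where L: "\<And>n. compact (L n)" "\<And>n. L n \<subseteq> A"
      "\<And>n. f n = emeasure lebesgue (L n + K)"
    by (metis (no_types, lifting) mem_Collect_eq)
  define I where "I = (\<Union>n. L n + K)"
  have "L n + K \<in> sets lebesgue" for n using L(1) K by (simp add: compact_set_plus)
  then have I: "I \<in> sets lebesgue" unfolding I_def by auto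
  have IAK: "I \<subseteq> A + K" unfolding I_def using L(2) by (intro UN_least set_plus_mono2) auto
  obtain H where H: "H \<in> sets lebesgue" "A + K \<subseteq> H" "?V = emeasure lebesgue H"
    using outer_measure_of_attain[of "A + K" lebesgue] by auto
  have HI: "emeasure lebesgue H \<le> emeasure lebesgue I"
    unfolding H(3)[symmetric] borel_plus_compact_inner_regular[OF A(1) K] f(2)
  proof (rule SUP_least)
    fix n show "f n \<le> emeasure lebesgue I"
      unfolding L(3) using I(1) by (intro emeasure_mono) (auto simp: I_def)
  qed
  have IH: "emeasure lebesgue I \<le> emeasure lebesgue H"
    using I IAK H by (intro emeasure_mono) auto
  have fin: "emeasure lebesgue I < \<infinity>"
  proof -
    have "bounded (A + K)" using A(2) K by (simp add: bounded_set_plus compact_imp_bounded)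
    then obtain R where "\<forall>x\<in>A + K. norm x \<le> R" unfolding bounded_iff by blast
    then have "A + K \<subseteq> cball 0 R" by auto
    then have "emeasure lebesgue I \<le> emeasure lebesgue (cball (0::'a) R)"
      using I IAK by (intro emeasure_mono) auto
    also have "\<dots> < \<infinity>" using emeasure_bounded_finite[of "cball (0::'a) R"] by simp
    finally show ?thesis .
  qed
  show ?thesis
    by (rule completion.complete_sets_sandwich[OF I H(1) IAK H(2) antisym[OF IH HI] fin])
qed

lemma borel_plus_compact_lebesgue:
  fixes A K :: "'a::euclidean_space set"
  assumes A: "A \<in> sets borel" and K: "compact K"
  shows "A + K \<in> sets lebesgue"
proof -
  let ?A = "\<lambda>n. A \<inter> cball 0 (real n)"
  have "A + K = (\<Union>n. ?A n + K)"
    by (rule plus_eq_UN_truncations)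
  moreover have "?A n + K \<in> sets lebesgue" for n
  proof (rule borel_plus_compact_lebesgue_bounded[OF _ _ K])
    show "bounded (?A n)" by (rule bounded_Int) auto
  qed (use A in auto)
  ultimately show ?thesis by auto
qed

section \<open>Growth of finite unions of dilates\<close>

definition minkowski_functional :: "'a::real_normed_vector set \<Rightarrow> 'a \<Rightarrow> real" where
  "minkowski_functional K x = Inf {t. 0 < t \<and> x \<in> dilate t K}"

context
  fixes K :: "'a::euclidean_space set"
  assumes K: "compact K" "convex K" "0 \<in> interior K"
begin

lemma zero_mem: "0 \<in> K"
  using K(3) interior_subset by blast

lemma dilate_mono: "0 \<le> s \<Longrightarrow> s \<le> t \<Longrightarrow> dilate s K \<subseteq> dilate t K"
proof -
  assume "0 \<le> s" "s \<le> t"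
  then have "dilate t K = dilate s K + dilate (t - s) K"
    using dilate_plus_dilate[OF K(2), of s "t - s"] by simp
  moreover have "0 \<in> dilate (t - s) K"
    using zero_mem by (auto simp: dilate_def image_iff intro!: bexI[of _ 0])
  ultimately show ?thesis by (metis set_zero_plus2 add.commute)
qed

lemma minkowski_functional_bdd: "bdd_below {t. 0 < t \<and> x \<in> dilate t K}"
  by (rule bdd_belowI[of _ 0]) auto

lemma minkowski_functional_upper: "0 < t \<Longrightarrow> x \<in> dilate t K \<Longrightarrow> minkowski_functional K x \<le> t"
  unfolding minkowski_functional_def by (intro cInf_lower minkowski_functional_bdd) auto

text \<open>
  The first bound makes the functional Lipschitz; the second shows that the infimum is taken over
  a nonempty set. Both come from a ball around the origin inside \<open>K\<close>.
\<close>
lemma minkowski_functional_linear_bound: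
  "\<exists>c>0. \<forall>x. minkowski_functional K x \<le> c * norm x \<and>
    (\<forall>t>0. c * norm x \<le> t \<longrightarrow> x \<in> dilate t K)"
proof -
  obtain e where e: "e > 0" "cball 0 e \<subseteq> K"
    using K(3) by (metis mem_interior_cball)
  have mem: "x \<in> dilate t K" if "t > 0" "1 / e * norm x \<le> t" for x t
  proof -
    have "(1 / t) *\<^sub>R x \<in> cball 0 e" using that e by (simp add: field_simps)
    then show ?thesis using that e mem_dilate_iff[of t x K] by auto
  qed
  have "minkowski_functional K x \<le> 1 / e * norm x" for x
  proof (rule field_le_epsilon)
    fix d :: real assume "d > 0"
    moreover have "0 \<le> 1 / e * norm x" using e by simp
    ultimately have "0 < 1 / e * norm x + d" "1 / e * norm x \<le> 1 / e * norm x + d" by linarith+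
    then show "minkowski_functional K x \<le> 1 / e * norm x + d"
      by (intro minkowski_functional_upper mem)
  qed
  with mem e show ?thesis by (intro exI[of _ "1 / e"]) auto
qed

lemma minkowski_functional_nonempty: "{t. 0 < t \<and> x \<in> dilate t K} \<noteq> {}"
proof -
  obtain c where c: "c > 0" "\<And>x t. t > 0 \<Longrightarrow> c * norm x \<le> t \<Longrightarrow> x \<in> dilate t K"
    using minkowski_functional_linear_bound by blast
  have "0 \<le> c * norm x" using c(1) by simp
  then have "c * norm x + 1 > 0" by linarith
  with c(2)[OF this, of x] show ?thesis by auto
qed

lemma minkowski_functional_less_imp_mem: "minkowski_functional K x < t \<Longrightarrow> x \<in> dilate t K"
proof -
  assume "minkowski_functional K x < t"
  then obtain s where "0 < s" "x \<in> dilate s K" "s < t"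
    unfolding minkowski_functional_def using cInf_less_iff[OF minkowski_functional_nonempty minkowski_functional_bdd] by auto
  then show ?thesis using dilate_mono[of s t] by auto
qed

lemma minkowski_functional_le_iff:
  assumes t: "t > 0"
  shows "minkowski_functional K x \<le> t \<longleftrightarrow> x \<in> dilate t K"
proof
  assume le: "minkowski_functional K x \<le> t"
  let ?s = "\<lambda>n::nat. t + 1 / real (Suc n)"
  have "(1 / ?s n) *\<^sub>R x \<in> K" for n
  proof -
    have "?s n > t" by simp
    with t have "?s n > 0" by linarith
    moreover have "x \<in> dilate (?s n) K"
      using le \<open>?s n > t\<close> by (intro minkowski_functional_less_imp_mem) linarith
    ultimately show ?thesis using mem_dilate_iff[of "?s n" x K] by simp
  qed
  moreover have "(\<lambda>n. (1 / ?s n) *\<^sub>R x) \<longlonglongrightarrow> (1 / (t + 0)) *\<^sub>R x"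
    using t by (intro tendsto_intros LIMSEQ_Suc[OF lim_1_over_n]) auto
  ultimately have "(1 / (t + 0)) *\<^sub>R x \<in> K"
    by (rule closed_sequentially[OF compact_imp_closed[OF K(1)]])
  with t show "x \<in> dilate t K" by (simp add: mem_dilate_iff)
qed (use t minkowski_functional_upper in auto)

lemma minkowski_functional_nonneg: "0 \<le> minkowski_functional K x"
  unfolding minkowski_functional_def by (intro cInf_greatest minkowski_functional_nonempty) auto

lemma minkowski_functional_scaleR_le:
  assumes "c > 0"
  shows "minkowski_functional K (c *\<^sub>R x) \<le> c * minkowski_functional K x"
proof (rule field_le_epsilon)
  fix e :: real assume e: "e > 0"
  let ?t = "minkowski_functional K x + e / c"
  have "minkowski_functional K x < ?t" "?t > 0"
    using e assms minkowski_functional_nonneg[of x] by (auto intro: add_nonneg_pos)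
  then have "x \<in> dilate ?t K" using minkowski_functional_less_imp_mem by blast
  then have "c *\<^sub>R x \<in> dilate (c * ?t) K"
    by (auto simp: dilate_def image_iff simp flip: scaleR_scaleR)
  then have "minkowski_functional K (c *\<^sub>R x) \<le> c * ?t"
    using \<open>?t > 0\<close> assms by (intro minkowski_functional_upper) auto
  then show "minkowski_functional K (c *\<^sub>R x) \<le> c * minkowski_functional K x + e"
    using assms by (simp add: algebra_simps)
qed

lemma minkowski_functional_scaleR:
  assumes "c > 0"
  shows "minkowski_functional K (c *\<^sub>R x) = c * minkowski_functional K x"
proof (rule antisym)
  have "minkowski_functional K ((1 / c) *\<^sub>R (c *\<^sub>R x)) \<le> (1 / c) * minkowski_functional K (c *\<^sub>R x)"
    using assms by (intro minkowski_functional_scaleR_le) simp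
  then show "c * minkowski_functional K x \<le> minkowski_functional K (c *\<^sub>R x)"
    using assms by (simp add: field_simps)
qed (use assms minkowski_functional_scaleR_le in blast)

lemma minkowski_functional_triangle: "minkowski_functional K (x + y) \<le> minkowski_functional K x + minkowski_functional K y"
proof (rule field_le_epsilon)
  fix e :: real assume e: "e > 0"
  let ?s = "minkowski_functional K x + e / 2" and ?t = "minkowski_functional K y + e / 2"
  have pos: "?s > 0" "?t > 0"
    using e minkowski_functional_nonneg[of x] minkowski_functional_nonneg[of y] by linarith+
  have "x \<in> dilate ?s K" "y \<in> dilate ?t K"
    using e by (auto intro!: minkowski_functional_less_imp_mem)
  then have "x + y \<in> dilate (?s + ?t) K"
    using dilate_plus_dilate[OF K(2), of ?s ?t] pos by (metis set_plus_intro less_imp_le)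
  then have "minkowski_functional K (x + y) \<le> ?s + ?t"
    using pos by (intro minkowski_functional_upper) auto
  then show "minkowski_functional K (x + y) \<le> minkowski_functional K x + minkowski_functional K y + e" by simp
qed

lemma continuous_minkowski_functional: "continuous_on UNIV (minkowski_functional K)"
proof -
  obtain c where c: "c > 0" "\<And>x. minkowski_functional K x \<le> c * norm x"
    using minkowski_functional_linear_bound by blast
  have "minkowski_functional K x - minkowski_functional K y \<le> c * dist x y" for x y
    using minkowski_functional_triangle[of "x - y" y] c(2)[of "x - y"] by (simp add: dist_norm)
  then have "dist (minkowski_functional K x) (minkowski_functional K y) \<le> c * dist x y" for x y
    by (smt (verit) dist_commute dist_real_def)
  then have "c-lipschitz_on UNIV (minkowski_functional K)"
    using c(1) by (intro lipschitz_onI) auto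
  then show ?thesis by (rule lipschitz_on_continuous_on)
qed

lemma borel_measurable_minkowski_functional [measurable]: "(\<lambda>x. minkowski_functional K (x - a)) \<in> borel_measurable borel"
  by (intro borel_measurable_continuous_onI continuous_on_compose2[OF continuous_minkowski_functional]
      continuous_intros) auto

text \<open>
  Assign each point to the nearest element of \<open>F\<close>, where distance is measured by the Minkowski
  functional of \<open>K\<close> and ties are broken by an injective numbering \<open>h\<close> of \<open>F\<close>. These Voronoi cells are
  star-shaped about their centres by the triangle inequality. Hence the contraction by \<open>r / s\<close> towards
  the centre \<open>a\<close> maps the part of the cell in \<open>a + s K\<close> into the part in \<open>a + r K\<close>, and the measures
  of the parts add up because the cells are disjoint.
\<close>
lemma finite_plus_dilate_measure_le:
  assumes F: "finite F" and rs: "0 < r" "r \<le> s"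
  shows "emeasure lebesgue (F + dilate s K)
           \<le> ennreal ((s / r) ^ DIM('a)) * emeasure lebesgue (F + dilate r K)"
proof -
  let ?g = "minkowski_functional K"
  obtain h :: "'a \<Rightarrow> nat" where h: "inj_on h F"
    using finite_imp_inj_to_nat_seg[OF F] by blast
  define V where "V a = {x. \<forall>b\<in>F. ?g (x - a) < ?g (x - b) \<or> ?g (x - a) = ?g (x - b) \<and> h a \<le> h b}" for a
  define S where "S t a = V a \<inter> {x. ?g (x - a) \<le> t}" for t a
  have [measurable]: "S t a \<in> sets borel" for t a
    unfolding S_def V_def using F by measurable
  have disj: "disjoint_family_on (S t) F" for t
    unfolding disjoint_family_on_def
  proof (intro ballI impI)
    fix a b assume ab: "a \<in> F" "b \<in> F" "a \<noteq> b"
    then have hab: "h a \<noteq> h b" using h by (auto dest: inj_onD)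
    have False if "x \<in> V a" "x \<in> V b" for x
    proof -
      have "?g (x - a) < ?g (x - b) \<or> ?g (x - a) = ?g (x - b) \<and> h a \<le> h b"
        using that(1) ab(2) unfolding V_def by blast
      moreover have "?g (x - b) < ?g (x - a) \<or> ?g (x - b) = ?g (x - a) \<and> h b \<le> h a"
        using that(2) ab(1) unfolding V_def by blast
      ultimately show False using hab by linarith
    qed
    then show "S t a \<inter> S t b = {}" unfolding S_def by blast
  qed
  have cover: "F + dilate t K = (\<Union>a\<in>F. S t a)" if t: "t > 0" for t
  proof (intro equalityI subsetI)
    fix x assume "x \<in> F + dilate t K"
    then obtain b k where b: "b \<in> F" "k \<in> dilate t K" "x = b + k" by (auto simp: set_plus_def)
    then have gb: "?g (x - b) \<le> t" using minkowski_functional_le_iff[OF t] by simp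
    \<comment> \<open>Among the nearest centres, the one with the least number owns \<open>x\<close>.\<close>
    let ?M = "{a \<in> F. \<forall>b\<in>F. ?g (x - a) \<le> ?g (x - b)}"
    have "finite ?M" using F by simp
    moreover have "?M \<noteq> {}"
      using arg_min_if_finite[OF F, of "\<lambda>a. ?g (x - a)"] b(1)
      by (smt (verit) empty_iff mem_Collect_eq)
    ultimately obtain a where a: "a \<in> ?M" "\<And>b. b \<in> ?M \<Longrightarrow> h a \<le> h b"
      using arg_min_if_finite[of ?M h] by (metis (no_types, lifting) linorder_not_le)
    have "x \<in> V a"
      unfolding V_def
    proof (intro CollectI ballI)
      fix b assume "b \<in> F"
      show "?g (x - a) < ?g (x - b) \<or> ?g (x - a) = ?g (x - b) \<and> h a \<le> h b"
      proof (cases "?g (x - a) = ?g (x - b)")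
        case True
        with a(1) \<open>b \<in> F\<close> have "b \<in> ?M" by auto
        with a(2) True show ?thesis by auto
      next
        case False
        with a(1) \<open>b \<in> F\<close> show ?thesis by force
      qed
    qed
    moreover have "?g (x - a) \<le> t" using a(1) b(1) gb by force
    ultimately show "x \<in> (\<Union>a\<in>F. S t a)" using a(1) unfolding S_def by blast
  next
    fix x assume "x \<in> (\<Union>a\<in>F. S t a)"
    then obtain a where a: "a \<in> F" "?g (x - a) \<le> t" unfolding S_def by blast
    then have "x - a \<in> dilate t K" using minkowski_functional_le_iff[OF t] by simp
    with a(1) have "a + (x - a) \<in> F + dilate t K" by (rule set_plus_intro)
    then show "x \<in> F + dilate t K" by simp
  qed
  have sum_eq: "emeasure lebesgue (F + dilate t K) = (\<Sum>a\<in>F. emeasure lebesgue (S t a))" if "t > 0" for t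
    unfolding cover[OF that]
    using F disj[of t] by (intro sum_emeasure[symmetric]) (auto simp: image_subset_iff)
  have cell: "emeasure lebesgue (S s a) \<le> ennreal ((s / r) ^ DIM('a)) * emeasure lebesgue (S r a)" for a
  proof -
    define c where "c = r / s"
    have c: "0 < c" "c \<le> 1" "c * s = r" using rs by (auto simp: c_def)
    have "(\<lambda>x. c *\<^sub>R x + (1 - c) *\<^sub>R a) ` S s a \<subseteq> S r a"
    proof
      fix y assume "y \<in> (\<lambda>x. c *\<^sub>R x + (1 - c) *\<^sub>R a) ` S s a"
      then obtain x where x: "x \<in> S s a" "y = c *\<^sub>R x + (1 - c) *\<^sub>R a" by blast
      have "y - a = c *\<^sub>R (x - a)" using x(2) by (simp add: algebra_simps)
      then have gy: "?g (y - a) = c * ?g (x - a)" using minkowski_functional_scaleR[OF c(1)] by simp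
      \<comment> \<open>Contraction towards \<open>a\<close> improves the comparison of \<open>a\<close> with every other centre.\<close>
      have shift: "?g (y - a) - ?g (x - a) \<le> ?g (y - b) - ?g (x - b)" for b
      proof (cases "c = 1")
        case True
        then show ?thesis using x(2) by simp
      next
        case False
        have "x - b = (1 - c) *\<^sub>R (x - a) + (y - b)" using x(2) by (simp add: algebra_simps)
        then have "?g (x - b) \<le> ?g ((1 - c) *\<^sub>R (x - a)) + ?g (y - b)"
          using minkowski_functional_triangle by metis
        also have "?g ((1 - c) *\<^sub>R (x - a)) = (1 - c) * ?g (x - a)"
          using False c(2) by (intro minkowski_functional_scaleR) simp
        finally show ?thesis using gy by (simp add: algebra_simps)
      qed
      have "?g (y - a) \<le> r"
        using x(1) c gy unfolding S_def by (metis (no_types, lifting) IntD2 mem_Collect_eq mult_left_mono less_imp_le)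
      moreover have "y \<in> V a"
        unfolding V_def
      proof (intro CollectI ballI)
        fix b assume "b \<in> F"
        then have "?g (x - a) < ?g (x - b) \<or> ?g (x - a) = ?g (x - b) \<and> h a \<le> h b"
          using x(1) unfolding S_def V_def by blast
        with shift[of b] show "?g (y - a) < ?g (y - b) \<or> ?g (y - a) = ?g (y - b) \<and> h a \<le> h b"
          by linarith
      qed
      ultimately show "y \<in> S r a" unfolding S_def by blast
    qed
    then have "emeasure lebesgue ((\<lambda>x. c *\<^sub>R x + (1 - c) *\<^sub>R a) ` S s a) \<le> emeasure lebesgue (S r a)"
      by (intro emeasure_mono) auto
    then have "ennreal (c ^ DIM('a)) * emeasure lebesgue (S s a) \<le> emeasure lebesgue (S r a)"
      using c(1) by (simp add: emeasure_lebesgue_affine ennreal_power)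
    then have "ennreal ((s / r) ^ DIM('a)) * (ennreal (c ^ DIM('a)) * emeasure lebesgue (S s a))
        \<le> ennreal ((s / r) ^ DIM('a)) * emeasure lebesgue (S r a)"
      by (rule mult_left_mono) simp
    also have "ennreal ((s / r) ^ DIM('a)) * (ennreal (c ^ DIM('a)) * emeasure lebesgue (S s a))
        = ennreal ((s / r * c) ^ DIM('a)) * emeasure lebesgue (S s a)"
      using rs c(1) unfolding power_mult_distrib by (simp add: ennreal_mult mult.assoc)
    also have "s / r * c = 1" using rs by (simp add: c_def)
    finally show ?thesis by simp
  qed
  show ?thesis
    unfolding sum_eq[OF rs(1)] sum_eq[OF less_le_trans[OF rs]] sum_distrib_left
    by (intro sum_mono cell)
qed

end

section \<open>Growth of sums with a convex body\<close>

text \<open>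
  Thickening \<open>K\<close> to \<open>K + cball 0 \<delta>\<close> gives it interior and at the same time absorbs the error made
  by replacing \<open>A\<close> with a finite \<open>s \<delta>\<close>-net; outer regularity of the compact set
  \<open>A + r K\<close> shows that the thickening costs arbitrarily little.
\<close>
lemma compact_plus_dilate_measure_le_if_zero_mem:
  fixes A K :: "'a::euclidean_space set"
  assumes A: "compact A" and K: "compact K" "convex K" "0 \<in> K" and rs: "0 < r" "r \<le> s"
  shows "emeasure lebesgue (A + dilate s K)
           \<le> ennreal ((s / r) ^ DIM('a)) * emeasure lebesgue (A + dilate r K)"
proof -
  let ?c = "(s / r) ^ DIM('a)"
  have s: "s > 0" and c: "?c > 0" using rs by auto
  have meas: "A + dilate r K \<in> sets lebesgue"
    using A K by (simp add: compact_set_plus compact_dilate)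
  show ?thesis
  proof (rule ennreal_le_epsilon)
    fix e :: real assume "e > 0"
    then have e: "e / ?c > 0" using c by simp
    obtain G where G: "open G" "A + dilate r K \<subseteq> G"
        "emeasure lebesgue (G - (A + dilate r K)) < ennreal (e / ?c)"
      using sets_lebesgue_outer_open[OF meas e] by metis
    have "compact (A + dilate r K)" using A K by (simp add: compact_set_plus compact_dilate)
    then obtain \<eta> where \<eta>: "\<eta> > 0" "(\<Union>x\<in>A + dilate r K. cball x \<eta>) \<subseteq> G"
      using G(1,2) by (rule compact_subset_open_imp_cball_epsilon_subset)
    \<comment> \<open>Dilation by \<open>r\<close> turns the thickening \<open>\<delta>\<close> of \<open>K\<close> into \<open>\<eta>\<close>.\<close>
    define \<delta> where "\<delta> = \<eta> / r"
    have \<delta>: "\<delta> > 0" using \<eta>(1) rs(1) by (simp add: \<delta>_def)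
    let ?K = "K + cball 0 \<delta>"
    have K': "compact ?K" "convex ?K"
      using K by (auto intro: compact_set_plus convex_set_plus)
    have "cball 0 \<delta> \<subseteq> ?K" using K(3) by (rule set_zero_plus2)
    then have int: "0 \<in> interior ?K" using \<delta> by (auto simp: mem_interior_cball)
    have "A \<subseteq> (\<Union>a\<in>A. ball a (s * \<delta>))" using \<delta> s by auto
    then obtain F where F: "F \<subseteq> A" "finite F" "A \<subseteq> (\<Union>a\<in>F. ball a (s * \<delta>))"
      using compactE_image[OF A, of A "\<lambda>a. ball a (s * \<delta>)"] by auto
    have "A \<subseteq> F + cball 0 (s * \<delta>)"
    proof
      fix x assume "x \<in> A"
      then obtain a where a: "a \<in> F" "dist a x < s * \<delta>" using F(3) by auto
      then have "x - a \<in> cball 0 (s * \<delta>)" by (simp add: dist_norm norm_minus_commute)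
      with a(1) have "a + (x - a) \<in> F + cball 0 (s * \<delta>)" by (rule set_plus_intro)
      then show "x \<in> F + cball 0 (s * \<delta>)" by simp
    qed
    then have "A + dilate s K \<subseteq> (F + cball 0 (s * \<delta>)) + dilate s K"
      by (rule set_plus_mono2) simp
    also have "\<dots> = F + dilate s ?K"
      using s by (simp add: dilate_set_plus dilate_cball add_ac)
    finally have "emeasure lebesgue (A + dilate s K) \<le> emeasure lebesgue (F + dilate s ?K)"
      using F(2) K'(1) by (intro emeasure_mono) (simp_all add: compact_set_plus compact_dilate finite_imp_compact)
    also have "\<dots> \<le> ennreal ?c * emeasure lebesgue (F + dilate r ?K)"
      using K' int F(2) rs by (rule finite_plus_dilate_measure_le)
    also have "\<dots> \<le> ennreal ?c * (emeasure lebesgue (A + dilate r K) + ennreal (e / ?c))"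
    proof (rule mult_left_mono)
      have "F + dilate r ?K \<subseteq> (A + dilate r K) + cball 0 \<eta>"
        using F(1) rs(1) by (simp add: dilate_set_plus dilate_cball \<delta>_def add.assoc[symmetric])
          (intro set_plus_mono2 order_refl)
      also have "\<dots> \<subseteq> G"
      proof
        fix z assume "z \<in> (A + dilate r K) + cball 0 \<eta>"
        then obtain x y where "x \<in> A + dilate r K" "y \<in> cball 0 \<eta>" "z = x + y"
          by (rule set_plus_elim)
        then have "z \<in> cball x \<eta>" by (simp add: dist_norm)
        then show "z \<in> G" using \<eta>(2) \<open>x \<in> A + dilate r K\<close> by blast
      qed
      finally have "emeasure lebesgue (F + dilate r ?K) \<le> emeasure lebesgue G"
        using G(1) by (intro emeasure_mono) auto
      also have "\<dots> = emeasure lebesgue ((A + dilate r K) \<union> (G - (A + dilate r K)))"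
        using G(2) by (simp add: Un_absorb1)
      also have "\<dots> \<le> emeasure lebesgue (A + dilate r K) + emeasure lebesgue (G - (A + dilate r K))"
        using meas G(1) by (intro emeasure_subadditive) auto
      also have "\<dots> \<le> emeasure lebesgue (A + dilate r K) + ennreal (e / ?c)"
        using G(3) by (intro add_left_mono) auto
      finally show "emeasure lebesgue (F + dilate r ?K) \<le> emeasure lebesgue (A + dilate r K) + ennreal (e / ?c)" .
    qed simp
    also have "\<dots> = ennreal ?c * emeasure lebesgue (A + dilate r K) + ennreal ?c * ennreal (e / ?c)"
      by (rule distrib_left)
    also have "ennreal ?c * ennreal (e / ?c) = ennreal e"
      using rs \<open>e > 0\<close> by (subst ennreal_mult[symmetric]) auto
    finally show "emeasure lebesgue (A + dilate s K) \<le> ennreal ?c * emeasure lebesgue (A + dilate r K) + ennreal e" .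
  qed
qed

lemma emeasure_lebesgue_translate:
  fixes S :: "'a::euclidean_space set"
  shows "emeasure lebesgue (S + {v}) = emeasure lebesgue S"
proof -
  have "S + {v} = (\<lambda>x. 1 *\<^sub>R x + v) ` S" by (auto simp: set_plus_def)
  then show ?thesis using emeasure_lebesgue_affine[of 1 v S] by simp
qed

text \<open>
  Translating \<open>K\<close> by \<open>v\<close> only translates \<open>A + t K\<close> by \<open>t v\<close>, so the origin may be assumed to lie in \<open>K\<close>.
\<close>
lemma compact_plus_dilate_measure_le:
  fixes A K :: "'a::euclidean_space set"
  assumes A: "compact A" and K: "compact K" "convex K" and rs: "0 < r" "r \<le> s"
  shows "emeasure lebesgue (A + dilate s K)
           \<le> ennreal ((s / r) ^ DIM('a)) * emeasure lebesgue (A + dilate r K)"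
proof (cases "K = {}")
  case True
  then show ?thesis by (simp add: dilate_def)
next
  case False
  then obtain v where v: "v \<in> K" by blast
  let ?K = "(\<lambda>x. x - v) ` K"
  have K': "compact ?K" "convex ?K" "0 \<in> ?K"
    using K v by (auto simp: compact_translation_subtract convex_translation_subtract)
  have "K = ?K + {v}" by (auto simp: set_plus_def image_iff)
  then have "A + dilate t K = (A + dilate t ?K) + {t *\<^sub>R v}" for t
    using dilate_set_plus[of t ?K "{v}"] by (simp add: dilate_def add.assoc)
  then have "emeasure lebesgue (A + dilate t K) = emeasure lebesgue (A + dilate t ?K)" for t
    by (metis emeasure_lebesgue_translate)
  then show ?thesis using compact_plus_dilate_measure_le_if_zero_mem[OF A K' rs] by simp
qed

lemma borel_plus_dilate_measure_le:
  fixes A K :: "'a::euclidean_space set"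
  assumes A: "A \<in> sets borel" and K: "compact K" "convex K" and rs: "0 < r" "r \<le> s"
  shows "emeasure lebesgue (A + dilate s K)
           \<le> ennreal ((s / r) ^ DIM('a)) * emeasure lebesgue (A + dilate r K)"
proof -
  let ?I = "{L. compact L \<and> L \<subseteq> A}"
  have meas: "A + dilate t K \<in> sets lebesgue" for t
    by (intro borel_plus_compact_lebesgue A compact_dilate K)
  have "emeasure lebesgue (A + dilate s K) = outer_measure_of lebesgue (A + dilate s K)"
    using meas by simp
  also have "\<dots> = (SUP L\<in>?I. emeasure lebesgue (L + dilate s K))"
    by (intro borel_plus_compact_inner_regular A compact_dilate K)
  also have "\<dots> \<le> ennreal ((s / r) ^ DIM('a)) * emeasure lebesgue (A + dilate r K)"
  proof (rule SUP_least)
    fix L assume L: "L \<in> ?I"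
    then have "emeasure lebesgue (L + dilate s K)
        \<le> ennreal ((s / r) ^ DIM('a)) * emeasure lebesgue (L + dilate r K)"
      using K rs by (intro compact_plus_dilate_measure_le) auto
    also have "\<dots> \<le> ennreal ((s / r) ^ DIM('a)) * emeasure lebesgue (A + dilate r K)"
      using L meas by (intro mult_left_mono emeasure_mono set_plus_mono2) auto
    finally show "emeasure lebesgue (L + dilate s K)
        \<le> ennreal ((s / r) ^ DIM('a)) * emeasure lebesgue (A + dilate r K)" .
  qed
  finally show ?thesis .
qed

section \<open>Surface measure\<close>

lemma tendsto_growth_quotient:
  fixes r v :: real
  assumes "r > 0"
  shows "((\<lambda>\<epsilon>. (((r + \<epsilon>) / r) ^ n * v - v) / \<epsilon>) \<longlongrightarrow> real n / r * v) (at_right 0)"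
proof -
  have "((\<lambda>\<epsilon>. ((r + \<epsilon>) / r) ^ n * v) has_real_derivative real n / r * v) (at 0)"
    using assms by (auto intro!: derivative_eq_intros)
  then have "((\<lambda>\<epsilon>. (((r + \<epsilon>) / r) ^ n * v - v) / \<epsilon>) \<longlongrightarrow> real n / r * v) (at 0)"
    using assms by (simp add: has_field_derivative_iff)
  then show ?thesis by (rule tendsto_mono[rotated]) (simp add: at_le)
qed

lemma upper_surface_wrt_le:
  fixes A K :: "'a::euclidean_space set"
  assumes r: "r > 0" and A: "A \<in> sets borel" and K: "compact K" "convex K"
  shows "upper_surface_wrt K (A + dilate r K) \<le> ereal (real DIM('a) / r) * vol (A + dilate r K)"
proof (cases "emeasure lebesgue (A + dilate r K)")
  case top
  then show ?thesis using r by (simp add: vol_def)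
next
  case (real v)
  let ?E = "A + dilate r K"
  have v: "vol ?E = ereal v" using real by (simp add: vol_def)
  let ?q = "\<lambda>\<epsilon>. (((r + \<epsilon>) / r) ^ DIM('a) * v - v) / \<epsilon>"
  have "(vol (?E + dilate \<epsilon> K) - vol ?E) / ereal \<epsilon> \<le> ereal (?q \<epsilon>)" if \<epsilon>: "\<epsilon> > 0" for \<epsilon>
  proof -
    have "emeasure lebesgue (A + dilate (r + \<epsilon>) K)
        \<le> ennreal (((r + \<epsilon>) / r) ^ DIM('a)) * emeasure lebesgue ?E"
      using A K r \<epsilon> by (intro borel_plus_dilate_measure_le) auto
    also have "\<dots> = ennreal (((r + \<epsilon>) / r) ^ DIM('a) * v)"
      using real r \<epsilon> by (simp add: ennreal_mult)
    finally have "vol (A + dilate (r + \<epsilon>) K) \<le> enn2ereal (ennreal (((r + \<epsilon>) / r) ^ DIM('a) * v))"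
      unfolding vol_def by (simp add: less_eq_ennreal.rep_eq)
    then have "vol (?E + dilate \<epsilon> K) \<le> ereal (((r + \<epsilon>) / r) ^ DIM('a) * v)"
      using real r \<epsilon> K(2) by (simp add: dilated_sum)
    then have "vol (?E + dilate \<epsilon> K) - vol ?E \<le> ereal (((r + \<epsilon>) / r) ^ DIM('a) * v) - ereal v"
      unfolding v by (rule ereal_minus_mono) simp
    then have "(vol (?E + dilate \<epsilon> K) - vol ?E) / ereal \<epsilon> \<le> (ereal (((r + \<epsilon>) / r) ^ DIM('a) * v) - ereal v) / ereal \<epsilon>"
      using \<epsilon> by (intro ereal_divide_right_mono) auto
    then show ?thesis using \<epsilon> by simp
  qed
  then have "upper_surface_wrt K ?E \<le> Limsup (at_right 0) (\<lambda>\<epsilon>. ereal (?q \<epsilon>))"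
    unfolding upper_surface_wrt_def
    by (intro Limsup_mono eventually_mono[OF eventually_at_right_less[of 0]]) auto
  also have "\<dots> = ereal (real DIM('a) / r * v)"
    using tendsto_growth_quotient[OF r] by (intro lim_imp_Limsup) auto
  finally show ?thesis by (simp add: v)
qed

text \<open>
  For a single dilate the growth bound is the exact homogeneity of Lebesgue measure.
\<close>
lemma upper_surface_wrt_dilate:
  fixes K :: "'a::euclidean_space set"
  assumes r: "r > 0" and K: "compact K" "convex K"
  shows "upper_surface_wrt K (dilate r K) = ereal (real DIM('a) / r) * vol (dilate r K)"
proof -
  have vol_dilate: "vol (dilate t K) = ereal (t ^ DIM('a) * measure lebesgue K)" if "t > 0" for t
  proof -
    have "emeasure lebesgue K = ennreal (measure lebesgue K)"
      using emeasure_eq_measure2[OF lmeasurable_compact[OF K(1)]] .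
    moreover have "emeasure lebesgue (dilate t K) = ennreal (t ^ DIM('a)) * emeasure lebesgue K"
      using emeasure_lebesgue_affine[of t 0 K] that by (simp add: dilate_def ennreal_power)
    ultimately have "emeasure lebesgue (dilate t K) = ennreal (t ^ DIM('a) * measure lebesgue K)"
      using that by (simp add: ennreal_mult)
    then show ?thesis using that by (simp add: vol_def)
  qed
  let ?v = "r ^ DIM('a) * measure lebesgue K"
  have "(vol (dilate r K + dilate \<epsilon> K) - vol (dilate r K)) / ereal \<epsilon>
      = ereal ((((r + \<epsilon>) / r) ^ DIM('a) * ?v - ?v) / \<epsilon>)" if "\<epsilon> > 0" for \<epsilon>
    using that r K(2) by (simp add: dilate_plus_dilate vol_dilate power_divide)
  then have "upper_surface_wrt K (dilate r K)
      = Limsup (at_right 0) (\<lambda>\<epsilon>. ereal ((((r + \<epsilon>) / r) ^ DIM('a) * ?v - ?v) / \<epsilon>))"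
    unfolding upper_surface_wrt_def
    by (intro Limsup_eq eventually_mono[OF eventually_at_right_less[of 0]]) auto
  also have "\<dots> = ereal (real DIM('a) / r * ?v)"
    using tendsto_growth_quotient[OF r] by (intro lim_imp_Limsup) auto
  finally show ?thesis using r by (simp add: vol_dilate)
qed

theorem theorem1:
  fixes A K :: "'a::euclidean_space set" and r :: real
  assumes "r > 0" and "A \<in> sets borel" and "compact K" and "convex K"
  shows "upper_surface_wrt K (A + dilate r K)
           \<le> ereal (real DIM('a) / r) * vol (A + dilate r K)
       \<and> upper_surface_wrt K ({0} + dilate r K)
           = ereal (real DIM('a) / r) * vol ({0} + dilate r K)
       \<and> upper_surface (A + dilate r (cball 0 1))
           \<le> ereal (real DIM('a) / r) * vol (A + dilate r (cball 0 1))"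
proof (intro conjI)
  show "upper_surface_wrt K (A + dilate r K) \<le> ereal (real DIM('a) / r) * vol (A + dilate r K)"
    using assms by (rule upper_surface_wrt_le)
  show "upper_surface_wrt K ({0} + dilate r K) = ereal (real DIM('a) / r) * vol ({0} + dilate r K)"
    using upper_surface_wrt_dilate[OF assms(1,3,4)] by simp
  show "upper_surface (A + dilate r (cball 0 1)) \<le> ereal (real DIM('a) / r) * vol (A + dilate r (cball 0 1))"
    using upper_surface_wrt_le[OF assms(1,2) compact_cball convex_cball]
    unfolding upper_surface_def upper_surface_wrt_def .
qed

end
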